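(* Let $(X,p)$ be a partial metric space, let $\mathcal{I}$ be a non-trivial admissible ideal of $\mathbb{N}$ and let $\{\xi_n\}$ be a sequence in $X$. Then for every $r\ge 0$ the rough $\mathcal{I}$-statistical limit set $\mathcal{I}\text{-}st\text{-}LIM^{r}\xi_n$ is a closed subset of $X$.
   Context: A partial metric on a non-empty set $X$ is a function $p:X\times X\to[0,\infty)$ such that for all $x,y,z\in X$: (p1) $0\le p(x,x)\le p(x,y)$; (p2) $x=y$ if and only if $p(x,x)=p(x,y)=p(y,y)$; (p3) $p(x,y)=p(y,x)$; (p4) $p(x,y)\le p(x,z)+p(z,y)-p(z,z)$. Then $(X,p)$ is called a partial metric space. The open ball with center $x\in X$ and radius $s>0$ is $B^{p}_{s}(x)=\{y\in X:p(x,y)<p(x,x)+s\}$; $X$ carries the topology having the open balls as a base, and "closed" refers to this topology. A sequence $\{x_n\}$ converges to $x$ in $(X,p)$ if $\lim_{n\to\infty}p(x_n,x)=p(x,x)$. An ideal of $\mathbb{N}$ is a family $\mathcal{I}\subset 2^{\mathbb{N}}$ containing $\emptyset$, closed under finite unions and under taking subsets; it is non-trivial if $\mathcal{I}\ne 2^{\mathbb{N}}$ and $\mathcal{I}\neq\{\emptyset\}$, and a non-trivial ideal is admissible if $\{n\}\in\mathcal{I}$ for every $n\in\mathbb{N}$. A sequence $\{\xi_n\}$ in $X$ is rough $\mathcal{I}$-statistically convergent to $\xi\in X$ of roughness degree $r\ge 0$ if for every $\varepsilon>0$ and $\delta>0$, $\left\{n\in\mathbb{N}:\frac{1}{n}\left|\{k\le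 n:|p(\xi_k,\xi)-p(\xi,\xi)|\ge r+\varepsilon\}\right|\ge\delta\right\}\in\mathcal{I}$. The set of all such $\xi\in X$ is the rough $\mathcal{I}$-statistical limit set, denoted $\mathcal{I}\text{-}st\text{-}LIM^{r}\xi_n$. *)

theory Defs
  imports "HOL-Analysis.Analysis"
begin

locale Partial_metric_space =
  fixes M :: "'a set" and p :: "'a \<Rightarrow> 'a \<Rightarrow> real"
  assumes nonempty: "M \<noteq> {}"
    and self_nonneg: "\<And>x. x \<in> M \<Longrightarrow> 0 \<le> p x x"
    and self_le: "\<And>x y. \<lbrakk>x \<in> M; y \<in> M\<rbrakk> \<Longrightarrow> p x x \<le> p x y"
    and eq_iff: "\<And>x y. \<lbrakk>x \<in> M; y \<in> M\<rbrakk> \<Longrightarrow> x = y \<longleftrightarrow> p x x = p x y \<and> p x y = p y y"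
    and commute: "\<And>x y. \<lbrakk>x \<in> M; y \<in> M\<rbrakk> \<Longrightarrow> p x y = p y x"
    and triangle: "\<And>x y z. \<lbrakk>x \<in> M; y \<in> M; z \<in> M\<rbrakk> \<Longrightarrow> p x y \<le> p x z + p z y - p z z"
begin

definition pball :: "'a \<Rightarrow> real \<Rightarrow> 'a set" where
  "pball x s = {y \<in> M. p x y < p x x + s}"

text \<open>The open sets are the unions of open balls; \<open>openin_ptopology\<close> below confirms that
  these do form a topology, so that the abstraction function is applied meaningfully.\<close>

definition ptopology :: "'a topology" where
  "ptopology = topology (arbitrary union_of (\<lambda>U. \<exists>x\<in>M. \<exists>s>0. U = pball x s))"

lemma istopology_pballs:
  "istopology (arbitrary union_of (\<lambda>U. \<exists>x\<in>M. \<exists>s>0. U = pball x s))"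
proof (rule istopology_base_alt[THEN iffD2], intro allI impI, elim conjE)
  fix S T
  assume S: "(arbitrary union_of (\<lambda>U. \<exists>x\<in>M. \<exists>s>0. U = pball x s)) S"
    and T: "(arbitrary union_of (\<lambda>U. \<exists>x\<in>M. \<exists>s>0. U = pball x s)) T"
  have sub: "\<exists>t>0. z \<in> pball z t \<and> pball z t \<subseteq> pball x s"
    if "x \<in> M" "z \<in> pball x s" for x z s
  proof (intro exI conjI subsetI)
    show "0 < p x x + s - p x z" "z \<in> pball z (p x x + s - p x z)"
      using that by (auto simp: pball_def)
    show "y \<in> pball x s" if y: "y \<in> pball z (p x x + s - p x z)" for y
      using that triangle[of x y z] \<open>x \<in> M\<close> \<open>z \<in> pball x s\<close> by (auto simp: pball_def)
  qed
  have inn: "\<exists>t>0. z \<in> M \<and> pball z t \<subseteq> W"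
    if W: "(arbitrary union_of (\<lambda>U. \<exists>x\<in>M. \<exists>s>0. U = pball x s)) W" and z: "z \<in> W" for W z
  proof -
    obtain U where "\<exists>x\<in>M. \<exists>s>0. U = pball x s" "z \<in> U" "U \<subseteq> W"
      using W z unfolding arbitrary_union_of_alt by meson
    then obtain x s where "x \<in> M" "z \<in> pball x s" "pball x s \<subseteq> W" by blast
    moreover have "z \<in> M" using \<open>z \<in> pball x s\<close> by (simp add: pball_def)
    ultimately show ?thesis using sub by blast
  qed
  show "(arbitrary union_of (\<lambda>U. \<exists>x\<in>M. \<exists>s>0. U = pball x s)) (S \<inter> T)"
    unfolding arbitrary_union_of_alt
  proof
    fix z assume z: "z \<in> S \<inter> T"
    obtain a where a: "a > 0" "z \<in> M" "pball z a \<subseteq> S" using inn[OF S] z by blast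
    obtain b where b: "b > 0" "pball z b \<subseteq> T" using inn[OF T] z by blast
    have "pball z (min a b) \<subseteq> S \<inter> T" using a b by (auto simp: pball_def)
    moreover have "z \<in> pball z (min a b)" using a b by (simp add: pball_def)
    ultimately show "\<exists>U. (\<exists>x\<in>M. \<exists>s>0. U = pball x s) \<and> z \<in> U \<and> U \<subseteq> S \<inter> T"
      using a b by (intro exI[of _ "pball z (min a b)"]) (metis min_less_iff_conj)
  qed
qed

lemma openin_ptopology:
  "openin ptopology U \<longleftrightarrow> (arbitrary union_of (\<lambda>U. \<exists>x\<in>M. \<exists>s>0. U = pball x s)) U"
  unfolding ptopology_def using istopology_pballs by (simp add: topology_inverse')

lemma topspace_ptopology: "topspace ptopology = M"
proof
  show "topspace ptopology \<subseteq> M"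
    unfolding topspace_def openin_ptopology arbitrary_union_of_alt by (auto simp: pball_def)
  have "openin ptopology M"
    unfolding openin_ptopology arbitrary_union_of_alt
  proof
    fix z assume "z \<in> M"
    then show "\<exists>U. (\<exists>x\<in>M. \<exists>s>0. U = pball x s) \<and> z \<in> U \<and> U \<subseteq> M"
      by (intro exI[of _ "pball z 1"]) (auto simp: pball_def intro!: exI[of _ 1])
  qed
  then show "M \<subseteq> topspace ptopology" by (rule openin_subset)
qed

end

definition set_ideal_on :: "'b set \<Rightarrow> 'b set set \<Rightarrow> bool" where
  "set_ideal_on S I \<longleftrightarrow>
     I \<subseteq> Pow S \<and> {} \<in> I \<and> (\<forall>A\<in>I. \<forall>B\<in>I. A \<union> B \<in> I) \<and> (\<forall>A\<in>I. \<forall>B. B \<subseteq> A \<longrightarrow> B \<in> I)"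

definition nontrivial_ideal_on :: "'b set \<Rightarrow> 'b set set \<Rightarrow> bool" where
  "nontrivial_ideal_on S I \<longleftrightarrow> set_ideal_on S I \<and> I \<noteq> Pow S \<and> I \<noteq> {{}}"

definition admissible_ideal_on :: "'b set \<Rightarrow> 'b set set \<Rightarrow> bool" where
  "admissible_ideal_on S I \<longleftrightarrow> nontrivial_ideal_on S I \<and> (\<forall>n\<in>S. {n} \<in> I)"

text \<open>Sequences are indexed by the positive integers \<open>{1..}\<close> (the mean over \<open>k \<le> n\<close> has
  denominator \<open>n\<close>); the value of a sequence at 0 is irrelevant.\<close>

definition rough_I_st_convergent ::
    "('a \<Rightarrow> 'a \<Rightarrow> real) \<Rightarrow> nat set set \<Rightarrow> real \<Rightarrow> (nat \<Rightarrow> 'a) \<Rightarrow> 'a \<Rightarrow> bool" where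
  "rough_I_st_convergent p I r \<xi> x \<longleftrightarrow>
     (\<forall>\<epsilon>>0. \<forall>\<delta>>0.
        {n \<in> {1..}. 1 / real n * real (card {k \<in> {1..n}. \<bar>p (\<xi> k) x - p x x\<bar> \<ge> r + \<epsilon>}) \<ge> \<delta>} \<in> I)"

definition rough_I_st_LIM ::
    "'a set \<Rightarrow> ('a \<Rightarrow> 'a \<Rightarrow> real) \<Rightarrow> nat set set \<Rightarrow> real \<Rightarrow> (nat \<Rightarrow> 'a) \<Rightarrow> 'a set" where
  "rough_I_st_LIM M p I r \<xi> = {x \<in> M. rough_I_st_convergent p I r \<xi> x}"

end

theory Submission
  imports Defs
begin

text \<open>If a limit point \<open>y\<close> lies within \<open>\<epsilon> / 2\<close> of \<open>z\<close>, i.e. \<open>p z y < p z z + \<epsilon> / 2\<close>, then the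
  triangle inequality through \<open>y\<close> cancels the self-distance \<open>p y y\<close>, so that
  \<open>p a y < p y y + r + \<epsilon> / 2\<close> forces \<open>p a z < p z z + r + \<epsilon>\<close>. Hence the exceptional indices for
  \<open>(z, \<epsilon>)\<close> are exceptional for \<open>(y, \<epsilon> / 2)\<close>, and every adherent point of the limit set belongs
  to it.\<close>

context Partial_metric_space
begin

text \<open>A point of \<open>M\<close> outside \<open>S\<close> is not adherent to
  \<open>S\<close>, so some ball centred at it misses \<open>S\<close>; these balls cover the
  complement, which is therefore open.\<close>

lemma closedin_ptopologyI:
  assumes "S \<subseteq> M"
    and adherent: "\<And>z. \<lbrakk>z \<in> M; \<And>s. s > 0 \<Longrightarrow> pball z s \<inter> S \<noteq> {}\<rbrakk> \<Longrightarrow> z \<in> S"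
  shows "closedin ptopology S"
  unfolding closedin_def topspace_ptopology openin_ptopology arbitrary_union_of_alt
proof (intro conjI ballI)
  show "S \<subseteq> M" by fact
  fix z assume z: "z \<in> M - S"
  then obtain s where s: "s > 0" "pball z s \<inter> S = {}"
    using adherent by blast
  then have "z \<in> pball z s" "pball z s \<subseteq> M - S"
    using z by (auto simp: pball_def)
  then show "\<exists>U. (\<exists>x\<in>M. \<exists>s>0. U = pball x s) \<and> z \<in> U \<and> U \<subseteq> M - S"
    using z s by blast
qed

lemma deviation_transfer:
  assumes "a \<in> M" "z \<in> M" "y \<in> pball z s" and dev: "t + s \<le> \<bar>p a z - p z z\<bar>"
  shows "t \<le> \<bar>p a y - p y y\<bar>"
proof -
  have y: "y \<in> M" "p z y < p z z + s"
    using assms by (auto simp: pball_def)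
  have "p a z \<le> p a y + p y z - p y y"
    using triangle assms y by blast
  \<comment> \<open>The second fact turns the absolute value in \<open>dev\<close> into the plain
    difference, which the triangle inequality bounds from above.\<close>
  moreover have "p y z = p z y" "p z z \<le> p a z"
    using commute[of y z] self_le[of z a] commute[of z a] assms y by auto
  ultimately show ?thesis
    using y dev by linarith
qed

lemma rough_I_st_convergent_adherent:
  assumes I: "\<And>A B. \<lbrakk>A \<in> I; B \<subseteq> A\<rbrakk> \<Longrightarrow> B \<in> I"
    and \<xi>: "\<And>n. n \<ge> 1 \<Longrightarrow> \<xi> n \<in> M"
    and z: "z \<in> M" "\<And>s. s > 0 \<Longrightarrow> pball z s \<inter> rough_I_st_LIM M p I r \<xi> \<noteq> {}"
  shows "rough_I_st_convergent p I r \<xi> z"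
  unfolding rough_I_st_convergent_def
proof (intro allI impI)
  fix \<epsilon> \<delta> :: real assume pos: "\<epsilon> > 0" "\<delta> > 0"
  define D where "D x e n = {k \<in> {1..n}. r + e \<le> \<bar>p (\<xi> k) x - p x x\<bar>}" for x e and n :: nat
  \<comment> \<open>Half of \<open>\<epsilon>\<close> is spent on the radius around
    \<open>z\<close>; the other half remains as tolerance at \<open>y\<close>.\<close>
  obtain y where y: "y \<in> pball z (\<epsilon> / 2)" "rough_I_st_convergent p I r \<xi> y"
    using z(2)[of "\<epsilon> / 2"] pos by (auto simp: rough_I_st_LIM_def)
  \<comment> \<open>Indices in \<open>D\<close> start at 1, so \<open>\<xi> k\<close> lies in
    \<open>M\<close> as the transfer requires.\<close>
  have "D z \<epsilon> n \<subseteq> D y (\<epsilon> / 2) n" for n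
    using deviation_transfer[OF \<xi> z(1) y(1), of _ "r + \<epsilon> / 2"] by (auto simp: D_def)
  then have "card (D z \<epsilon> n) \<le> card (D y (\<epsilon> / 2) n)" for n
    by (intro card_mono) (simp_all add: D_def)
  then have "1 / real n * real (card (D z \<epsilon> n)) \<le> 1 / real n * real (card (D y (\<epsilon> / 2) n))" for n
    by (intro mult_left_mono) auto
  \<comment> \<open>The means at \<open>y\<close> dominate those at \<open>z\<close>, so the same
    \<open>\<delta>\<close> serves both and downward closure of \<open>I\<close> concludes.\<close>
  then have "{n \<in> {1..}. \<delta> \<le> 1 / real n * real (card (D z \<epsilon> n))}
      \<subseteq> {n \<in> {1..}. \<delta> \<le> 1 / real n * real (card (D y (\<epsilon> / 2) n))}"
    using order_trans by blast
  moreover have "{n \<in> {1..}. \<delta> \<le> 1 / real n * real (card (D y (\<epsilon> / 2) n))} \<in> I"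
    using y(2) pos unfolding rough_I_st_convergent_def D_def by (meson half_gt_zero)
  ultimately show "{n \<in> {1..}. \<delta> \<le> 1 / real n *
      real (card {k \<in> {1..n}. r + \<epsilon> \<le> \<bar>p (\<xi> k) z - p z z\<bar>})} \<in> I"
    using I unfolding D_def by blast
qed

end

theorem theorem3p4:
  fixes X :: "'a set" and p :: "'a \<Rightarrow> 'a \<Rightarrow> real"
    and I :: "nat set set" and \<xi> :: "nat \<Rightarrow> 'a" and r :: real
  assumes "Partial_metric_space X p"
    and "admissible_ideal_on {1..} I"
    and "\<And>n. n \<ge> 1 \<Longrightarrow> \<xi> n \<in> X"
    and "r \<ge> 0"
  shows "closedin (Partial_metric_space.ptopology X p) (rough_I_st_LIM X p I r \<xi>)"
proof -
  interpret Partial_metric_space X p by fact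
  have I: "B \<in> I" if "A \<in> I" "B \<subseteq> A" for A B
    using assms(2) that
    unfolding admissible_ideal_on_def nontrivial_ideal_on_def set_ideal_on_def by blast
  show ?thesis
  proof (rule closedin_ptopologyI)
    show "rough_I_st_LIM X p I r \<xi> \<subseteq> X"
      by (auto simp: rough_I_st_LIM_def)
    fix z assume "z \<in> X" "\<And>s. s > 0 \<Longrightarrow> pball z s \<inter> rough_I_st_LIM X p I r \<xi> \<noteq> {}"
    then show "z \<in> rough_I_st_LIM X p I r \<xi>"
      using rough_I_st_convergent_adherent[OF I assms(3)] by (simp add: rough_I_st_LIM_def)
  qed
qed

end
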